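(* For all permutations $\rho_1$ of $\{1,\dots,n\}$ and $\rho_2$ of $\{1,\dots,m\}$, $$N(\overline{\rho_1}\Vert\rho_2)=N(\rho_1\Vert\rho_2).$$
   Context: Permutations are composed from right to left; $(i\ j)$ denotes the transposition exchanging $i$ and $j$, and $(i\ i)$ denotes the identity. The multiplicity $N(\pi)$ of a permutation $\pi$ of $\{1,\dots,n\}$ is the number of sequences $(a_1,\dots,a_n)\in\{1,\dots,n\}^n$ with $\pi=(n\ a_n)\cdots(2\ a_2)(1\ a_1)$. If $\pi$ is a permutation of $\{1,\dots,n\}$ and $\rho$ is a permutation of $\{1,\dots,m\}$, their concatenation $\pi\Vert\rho$ is the permutation of $\{1,\dots,m+n\}$ with $(\pi\Vert\rho)(j)=\pi(j)$ for $1\le j\le n$ and $(\pi\Vert\rho)(j)=n+\rho(j-n)$ for $n+1\le j\le m+n$. Let $\sigma_n$ be the permutation of $\{1,\dots,n\}$ sending each $i$ to $n+1-i$. The flip of a permutation $\pi$ of $\{1,\dots,n\}$ is $\overline{\pi}=\sigma_n\pi^{-1}\sigma_n$. *)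

theory Defs
  imports "HOL-Combinatorics.Permutations" "HOL-Library.FuncSet"
begin

text \<open>
  A permutation of \<open>{1..n}\<close> is a function \<open>p :: nat \<Rightarrow> nat\<close> with \<open>p permutes {1..n}\<close>; it fixes
  every number outside \<open>{1..n}\<close>. Accordingly, the operations below are defined to be the identity
  outside the relevant interval.
\<close>

text \<open>The product \<open>(k a\<^sub>k) \<cdots> (2 a\<^sub>2) (1 a\<^sub>1)\<close>, in which the factor \<open>(1 a\<^sub>1)\<close> acts first.\<close>

primrec transposition_product :: "(nat \<Rightarrow> nat) \<Rightarrow> nat \<Rightarrow> nat \<Rightarrow> nat" where
  "transposition_product a 0 = id"
| "transposition_product a (Suc k) =
     transpose (Suc k) (a (Suc k)) \<circ> transposition_product a k"

text \<open>
  The sequences are extensional functions (constantly \<open>undefined\<close> outside \<open>{1..n}\<close>), so that each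
  \<open>(a\<^sub>1, \<dots>, a\<^sub>n)\<close> is counted exactly once.
\<close>

definition multiplicity_perm :: "nat \<Rightarrow> (nat \<Rightarrow> nat) \<Rightarrow> nat" where
  "multiplicity_perm n p =
     card {a \<in> {1..n} \<rightarrow>\<^sub>E {1..n}. p = transposition_product a n}"

definition concat_perm :: "nat \<Rightarrow> nat \<Rightarrow> (nat \<Rightarrow> nat) \<Rightarrow> (nat \<Rightarrow> nat) \<Rightarrow> nat \<Rightarrow> nat" where
  "concat_perm n m p r j =
     (if j \<in> {1..n} then p j
      else if j \<in> {n + 1..m + n} then n + r (j - n)
      else j)"

definition reversal_perm :: "nat \<Rightarrow> nat \<Rightarrow> nat" where
  "reversal_perm n i = (if i \<in> {1..n} then n + 1 - i else i)"

definition flip_perm :: "nat \<Rightarrow> (nat \<Rightarrow> nat) \<Rightarrow> nat \<Rightarrow> nat" where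
  "flip_perm n p = reversal_perm n \<circ> inv p \<circ> reversal_perm n"

lemma reversal_perm_permutes: "reversal_perm n permutes {1..n}"
proof (rule bij_imp_permutes)
  show "bij_betw (reversal_perm n) {1..n} {1..n}"
    by (rule bij_betw_byWitness[where f' = "reversal_perm n"]) (auto simp: reversal_perm_def)
qed (auto simp: reversal_perm_def)

lemma flip_perm_permutes:
  assumes "p permutes {1..n}"
  shows "flip_perm n p permutes {1..n}"
  unfolding flip_perm_def
  by (intro permutes_compose reversal_perm_permutes permutes_inv assms)

lemma concat_perm_permutes:
  assumes p: "p permutes {1..n}" and r: "r permutes {1..m}"
  shows "concat_perm n m p r permutes {1..m + n}"
proof (rule bij_imp_permutes)
  have p_in: "p j \<in> {1..n}" if "j \<in> {1..n}" for j
    using permutes_in_image[OF p] that by blast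
  have r_in: "r j \<in> {1..m}" if "j \<in> {1..m}" for j
    using permutes_in_image[OF r] that by blast
  have inj: "inj_on (concat_perm n m p r) {1..m + n}"
  proof (rule inj_onI)
    fix i j
    assume ij: "i \<in> {1..m + n}" "j \<in> {1..m + n}"
      and eq: "concat_perm n m p r i = concat_perm n m p r j"
    have low: "concat_perm n m p r k = p k \<and> p k \<le> n" if "k \<in> {1..m + n}" "k \<le> n" for k
      using that p_in[of k] by (auto simp: concat_perm_def)
    have high: "concat_perm n m p r k = n + r (k - n) \<and> r (k - n) \<ge> 1"
      if "k \<in> {1..m + n}" "\<not> k \<le> n" for k
    proof -
      have "k - n \<in> {1..m}" using that by auto
      then show ?thesis using that r_in[of "k - n"] by (auto simp: concat_perm_def)
    qed
    show "i = j"
    proof (cases "i \<le> n"; cases "j \<le> n")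
      assume "i \<le> n" "j \<le> n"
      then have "p i = p j" using low ij eq by simp
      then show ?thesis using permutes_inj[OF p] by (simp add: inj_eq)
    next
      assume "i \<le> n" "\<not> j \<le> n"
      then show ?thesis using low[of i] high[of j] ij eq by simp
    next
      assume "\<not> i \<le> n" "j \<le> n"
      then show ?thesis using low[of j] high[of i] ij eq by simp
    next
      assume *: "\<not> i \<le> n" "\<not> j \<le> n"
      then have "r (i - n) = r (j - n)" using high ij eq by simp
      then have "i - n = j - n" using permutes_inj[OF r] by (simp add: inj_eq)
      then show ?thesis using * by simp
    qed
  qed
  have "concat_perm n m p r j \<in> {1..m + n}" if "j \<in> {1..m + n}" for j
  proof (cases "j \<le> n")
    case True
    then show ?thesis using that p_in[of j] by (auto simp: concat_perm_def)
  next
    case False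
    then have "j - n \<in> {1..m}" using that by auto
    then show ?thesis using that False r_in[of "j - n"] by (auto simp: concat_perm_def)
  qed
  then have "concat_perm n m p r ` {1..m + n} \<subseteq> {1..m + n}" by blast
  with inj show "bij_betw (concat_perm n m p r) {1..m + n} {1..m + n}"
    by (simp add: bij_betw_def endo_inj_surj)
qed (auto simp: concat_perm_def)

end

theory Submission
  imports Defs "HOL-Combinatorics.Orbits"
begin

text \<open>
  Write \<open>U = {1..m + n}\<close>, \<open>S = {1..n}\<close> (the small points) and \<open>T = U - S\<close> (the large points), and
  split a factorization into its first \<open>n\<close> and its last \<open>m\<close> factors. If \<open>A x\<close> and \<open>B x\<close> count the ways
  to write \<open>x\<close> as a product \<open>(n a\<^sub>n) \<cdots> (1 a\<^sub>1)\<close> and \<open>(m+n a\<^bsub>m+n\<^esub>) \<cdots> (n+1 a\<^bsub>n+1\<^esub>)\<close> respectively,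
  every \<open>a\<^sub>i\<close> ranging over all of \<open>U\<close>, then the multiplicity of \<open>\<pi>\<close> is the convolution
  \<open>\<Sum>\<^sub>x B (\<pi> x\<inverse>) A x\<close>.

  The symmetries of the problem become invariances of these two functions: \<open>A\<close> is invariant under
  conjugation by permutations of \<open>T\<close>, \<open>B\<close> under conjugation by permutations of \<open>S\<close>, and
  \<open>A (\<sigma> x\<inverse> \<sigma>) = A x\<close> for the reversal \<open>\<sigma>\<close> of \<open>S\<close>, because inverting a product reverses the order of
  its factors and conjugating by \<open>\<sigma>\<close> puts the centres back in order. Let \<open>\<tau>\<close> permute \<open>S\<close> and \<open>\<rho>\<close>
  permute \<open>T\<close>. These invariances, and the fact that \<open>\<rho>\<close> commutes with \<open>\<sigma>\<close> and \<open>\<tau>\<close>, turn the multiplicity of \<open>\<tau>\<rho>\<close> into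
  \<open>\<Sum>\<^sub>z A (\<tau> z) B (\<rho> z\<inverse>)\<close> and that of \<open>(\<sigma> \<tau>\<inverse> \<sigma>) \<rho>\<close> into \<open>\<Sum>\<^sub>z A (\<tau> z) B (\<rho> z)\<close>. So the theorem says
  that in the second factor \<open>z\<close> may be replaced by its inverse.

  This holds because of the supports. In a product \<open>(n a\<^sub>n) \<cdots> (1 a\<^sub>1)\<close> the graph with edges
  \<open>i \<rightarrow> a\<^sub>i\<close> has out-degree at most one, and the large points are its sinks; hence a component, and a
  fortiori a cycle of the product, contains at most one large point
  (\<open>factorization_count_support\<close>). Therefore \<open>A (\<tau> z) \<noteq> 0\<close> forces \<open>z\<close> to send no large point to another
  large point, and symmetrically \<open>B (\<rho> z) \<noteq> 0\<close> or \<open>B (\<rho> z\<inverse>) \<noteq> 0\<close> does so for small points. A relevant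
  \<open>z\<close> thus has only fixed points and cycles in which small and large points alternate. Such a cycle
  can be read backwards, so \<open>z\<inverse>\<close> is conjugate to \<open>z\<close> by a permutation that preserves \<open>S\<close> and \<open>T\<close>
  (\<open>alternating_permutation_reversible\<close>). Averaging \<open>B (\<rho> z)\<close> over the conjugates of \<open>z\<close> by
  permutations of \<open>T\<close>, which the invariance of \<open>A\<close> permits, makes the second factor invariant under
  conjugation by all permutations of \<open>U\<close> that preserve \<open>S\<close>, and it then takes equal values at \<open>z\<close> and \<open>z\<inverse>\<close>
  (\<open>sum_mult_inverse_argument\<close>).
\<close>

section \<open>Counting factorizations with prescribed centres\<close>

text \<open>
  The centres form a list whose head is the factor that acts last. Allowing arbitrary lists of centres
  makes it possible to cut a product into two blocks, to reverse it and to conjugate it.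
\<close>

fun factorization_count :: "'a set \<Rightarrow> 'a list \<Rightarrow> ('a \<Rightarrow> 'a) \<Rightarrow> nat" where
  "factorization_count U [] p = (if p = id then 1 else 0)"
| "factorization_count U (x # xs) p =
     (\<Sum>a\<in>U. factorization_count U xs (transpose x a \<circ> p))"

lemma card_transposition_products:
  assumes "finite U"
  shows "card {a \<in> {1..k} \<rightarrow>\<^sub>E U. p = transposition_product a k}
       = factorization_count U (rev [1..<Suc k]) p"
proof (induction k arbitrary: p)
  case 0
  then show ?case by (auto simp: PiE_empty_domain)
next
  case (Suc k)
  have cong: "transposition_product (f(Suc k := y)) k = transposition_product f k" for f y
  proof -
    have "j \<le> k \<Longrightarrow> transposition_product (f(Suc k := y)) j = transposition_product f j" for j
      by (induction j) auto
    then show ?thesis by simp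
  qed
  let ?E = "\<lambda>b. {a \<in> {1..k} \<rightarrow>\<^sub>E U. transpose (Suc k) b \<circ> p = transposition_product a k}"
  have fin: "finite (?E b)" for b
    by (rule finite_subset[OF _ finite_PiE[of "{1..k}" "\<lambda>_. U"]]) (auto simp: assms)
  have "bij_betw (\<lambda>(b, a). a(Suc k := b)) (SIGMA b:U. ?E b)
      {a \<in> {1..Suc k} \<rightarrow>\<^sub>E U. p = transposition_product a (Suc k)}"
  proof (rule bij_betw_byWitness[where f' = "\<lambda>a. (a (Suc k), a(Suc k := undefined))"])
    show "\<forall>ba\<in>SIGMA b:U. ?E b. (\<lambda>a. (a (Suc k), a(Suc k := undefined)))
        ((\<lambda>(b, a). a(Suc k := b)) ba) = ba"
      by (auto simp: PiE_def extensional_def fun_eq_iff)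
    show "\<forall>a\<in>{a \<in> {1..Suc k} \<rightarrow>\<^sub>E U. p = transposition_product a (Suc k)}.
        (\<lambda>(b, a). a(Suc k := b)) (a (Suc k), a(Suc k := undefined)) = a"
      by auto
    show "(\<lambda>(b, a). a(Suc k := b)) ` (SIGMA b:U. ?E b)
        \<subseteq> {a \<in> {1..Suc k} \<rightarrow>\<^sub>E U. p = transposition_product a (Suc k)}"
    proof clarify
      fix b a
      assume b: "b \<in> U" and a: "a \<in> {1..k} \<rightarrow>\<^sub>E U"
        and eq: "transpose (Suc k) b \<circ> p = transposition_product a k"
      have "a(Suc k := b) \<in> {1..Suc k} \<rightarrow>\<^sub>E U"
        using a b by (auto simp: PiE_def extensional_def Pi_def)
      moreover have "p = transpose (Suc k) b \<circ> (transpose (Suc k) b \<circ> p)"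
        by (simp add: fun_eq_iff)
      then have "p = transposition_product (a(Suc k := b)) (Suc k)"
        by (simp add: cong eq)
      ultimately show "a(Suc k := b) \<in> {1..Suc k} \<rightarrow>\<^sub>E U
          \<and> p = transposition_product (a(Suc k := b)) (Suc k)" by simp
    qed
    show "(\<lambda>a. (a (Suc k), a(Suc k := undefined)))
        ` {a \<in> {1..Suc k} \<rightarrow>\<^sub>E U. p = transposition_product a (Suc k)} \<subseteq> (SIGMA b:U. ?E b)"
      by (auto simp: cong fun_eq_iff PiE_def extensional_def Pi_def)
  qed
  then have "card {a \<in> {1..Suc k} \<rightarrow>\<^sub>E U. p = transposition_product a (Suc k)}
      = card (SIGMA b:U. ?E b)"
    by (simp add: bij_betw_same_card)
  also have "\<dots> = (\<Sum>b\<in>U. card (?E b))"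
    using assms fin by simp
  also have "\<dots> = factorization_count U (rev [1..<Suc (Suc k)]) p"
    unfolding Suc.IH by simp
  finally show ?case .
qed

lemma multiplicity_perm_eq:
  "multiplicity_perm n p = factorization_count {1..n} (rev [1..<Suc n]) p"
  unfolding multiplicity_perm_def by (rule card_transposition_products) simp

text \<open>
  Cutting a product into two blocks is multiplication in the group algebra: \<open>q\<close> is the value of the
  block that acts first.
\<close>

lemma factorization_count_append:
  assumes "finite U" "set xs \<subseteq> U" "p permutes U"
  shows "factorization_count U (xs @ ys) p
       = (\<Sum>q | q permutes U. factorization_count U xs (p \<circ> inv q) * factorization_count U ys q)"
  using assms(2,3)
proof (induction xs arbitrary: p)
  case Nil
  have "p \<circ> inv q = id \<longleftrightarrow> q = p" if "q permutes U" for q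
  proof
    assume "p \<circ> inv q = id"
    then have "p \<circ> inv q \<circ> q = q" by simp
    then show "q = p" by (simp add: comp_assoc permutes_inv_o[OF that])
  next
    assume "q = p"
    then show "p \<circ> inv q = id" using permutes_inv_o(1)[OF that] by simp
  qed
  then have "(\<Sum>q | q permutes U. factorization_count U [] (p \<circ> inv q) * factorization_count U ys q)
      = (\<Sum>q | q permutes U. if q = p then factorization_count U ys q else 0)"
    by (intro sum.cong) (auto simp only: factorization_count.simps mem_Collect_eq split: if_split)
  also have "\<dots> = factorization_count U ([] @ ys) p"
    using Nil assms(1) by (simp add: finite_permutations sum.delta)
  finally show ?case by (rule sym)
next
  case (Cons x xs)
  have "factorization_count U (xs @ ys) (transpose x a \<circ> p) = (\<Sum>q | q permutes U.
      factorization_count U xs (transpose x a \<circ> p \<circ> inv q) * factorization_count U ys q)"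
    if "a \<in> U" for a
    using that Cons.prems by (intro Cons.IH permutes_compose permutes_swap_id) auto
  then have "factorization_count U ((x # xs) @ ys) p = (\<Sum>a\<in>U. \<Sum>q | q permutes U.
      factorization_count U xs (transpose x a \<circ> p \<circ> inv q) * factorization_count U ys q)"
    by (simp only: append_Cons factorization_count.simps cong: sum.cong)
  also have "\<dots> = (\<Sum>q | q permutes U.
      factorization_count U (x # xs) (p \<circ> inv q) * factorization_count U ys q)"
    by (subst sum.swap) (simp only: factorization_count.simps sum_distrib_right comp_assoc)
  finally show ?case .
qed

lemma factorization_count_snoc:
  "factorization_count U (xs @ [x]) p = (\<Sum>a\<in>U. factorization_count U xs (p \<circ> transpose x a))"
proof (induction xs arbitrary: p)
  case Nil
  have "transpose x a \<circ> p = id \<longleftrightarrow> p \<circ> transpose x a = id" for a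
    by (metis comp_assoc comp_id id_comp transpose_comp_involutory)
  then show ?case by (simp only: append_Nil factorization_count.simps)
next
  case (Cons y xs)
  then show ?case by (simp add: comp_assoc del: comp_apply) (rule sum.swap)
qed

text \<open>Transpositions are involutions, so inverting a product only reverses the order of its factors.\<close>

lemma factorization_count_inverse:
  assumes "bij p"
  shows "factorization_count U xs (inv p) = factorization_count U (rev xs) p"
  using assms
proof (induction xs arbitrary: p)
  case Nil
  then show ?case by (metis factorization_count.simps(1) inv_id inv_inv_eq rev.simps(1))
next
  case (Cons x xs)
  have "transpose x a \<circ> inv p = inv (p \<circ> transpose x a)" for a
    using Cons.prems by (simp add: o_inv_distrib)
  moreover have "factorization_count U xs (inv (p \<circ> transpose x a))
      = factorization_count U (rev xs) (p \<circ> transpose x a)" for a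
    using Cons.prems by (intro Cons.IH) (rule bij_comp, simp_all)
  ultimately show ?case
    by (simp add: factorization_count_snoc)
qed

text \<open>
  Conjugating by \<open>c\<close> turns \<open>(x a)\<close> into \<open>(c x c a)\<close>, and \<open>c a\<close> ranges over \<open>U\<close> when \<open>a\<close> does.
\<close>

lemma factorization_count_conjugate:
  assumes "c permutes U"
  shows "factorization_count U (map c xs) (c \<circ> p \<circ> inv c) = factorization_count U xs p"
proof (induction xs arbitrary: p)
  case Nil
  have "c \<circ> p \<circ> inv c = id \<longleftrightarrow> p = id"
    by (metis assms comp_assoc comp_id id_comp permutes_inv_o)
  then show ?case by (simp only: list.map factorization_count.simps)
next
  case (Cons x xs)
  have conj: "transpose (c x) (c a) \<circ> (c \<circ> p \<circ> inv c) = c \<circ> (transpose x a \<circ> p) \<circ> inv c" for a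
    using permutes_inj[OF assms]
    by (auto simp: fun_eq_iff transpose_def inj_eq)
  have "factorization_count U (map c (x # xs)) (c \<circ> p \<circ> inv c)
      = (\<Sum>a\<in>U. factorization_count U (map c xs) (transpose (c x) (c a) \<circ> (c \<circ> p \<circ> inv c)))"
    using sum.permute[OF assms] by (simp add: o_def)
  also have "\<dots> = factorization_count U (x # xs) p"
    unfolding conj Cons.IH by simp
  finally show ?case .
qed

lemma factorization_count_conjugate_fixing:
  assumes "c permutes V" "V \<subseteq> U" "set xs \<inter> V = {}"
  shows "factorization_count U xs (c \<circ> p \<circ> inv c) = factorization_count U xs p"
proof -
  have "map c xs = xs"
    using assms by (intro map_idI) (auto simp: permutes_def)
  then show ?thesis
    using factorization_count_conjugate[OF permutes_subset[OF assms(1,2)], of xs p] by simp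
qed

text \<open>
  Join each centre \<open>x\<close> to the point \<open>a\<close> it is exchanged with. Every centre has one outgoing edge and the
  other points have none, so each component contains at most one non-centre, and a product of these
  transpositions never leaves a component. The proof builds the map \<open>r\<close> that names the components: it
  is constant along the product and fixes every non-centre.
\<close>

lemma factorization_count_support:
  assumes "factorization_count U xs p \<noteq> 0" "distinct xs" "y \<notin> set xs" "p y \<notin> set xs"
  shows "p y = y"
proof -
  have "\<exists>r. r \<circ> p = r \<and> (\<forall>v. v \<notin> set xs \<longrightarrow> r v = v)"
    using assms(1,2)
  proof (induction xs arbitrary: p)
    case Nil
    then show ?case by (intro exI[of _ id]) (auto split: if_splits)
  next
    case (Cons x xs)
    obtain a where "factorization_count U xs (transpose x a \<circ> p) \<noteq> 0"
      using Cons.prems(1) by (metis factorization_count.simps(2) sum.not_neutral_contains_not_neutral)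
    then obtain r where r: "r \<circ> (transpose x a \<circ> p) = r" and fixed: "\<And>v. v \<notin> set xs \<Longrightarrow> r v = v"
      using Cons by (metis distinct.simps(2))
    \<comment> \<open>The component named \<open>x\<close> is merged into the component of \<open>a\<close>.\<close>
    let ?s = "id(x := r a) \<circ> r"
    have "r x = x" using fixed Cons.prems(2) by simp
    then have "?s (transpose x a w) = ?s w" for w
      by (auto simp: transpose_def)
    then have "?s \<circ> p = ?s \<circ> (transpose x a \<circ> p)"
      by (simp add: fun_eq_iff)
    also have "\<dots> = ?s"
      using r by (simp add: comp_assoc)
    finally show ?case
      by (rule exI[of _ ?s, OF conjI]) (simp add: fixed)
  qed
  then show ?thesis
    using assms(3,4) by (metis comp_apply)
qed

section \<open>Reversing alternating cycles\<close>

lemma funpow_inverse_eq: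
  assumes "bij z" "(z ^^ i) r = (z ^^ j) r"
  shows "(inv z ^^ i) r = (inv z ^^ j) r"
proof -
  have inv_pow: "(inv z ^^ l) ((z ^^ l) v) = v" for l v
    using inv_fn_o_fn_is_id[OF assms(1), of l] by (metis comp_apply)
  have "(inv z ^^ i) r = (inv z ^^ i) ((inv z ^^ j) ((z ^^ j) r))"
    by (simp only: inv_pow)
  also have "\<dots> = (inv z ^^ j) ((inv z ^^ i) ((z ^^ i) r))"
    unfolding assms(2) by (metis add.commute comp_apply funpow_add)
  finally show ?thesis by (simp only: inv_pow)
qed

lemma funpow_inverse_swap:
  assumes "bij z" "(inv z ^^ i) r = (z ^^ j) r"
  shows "(inv z ^^ j) r = (z ^^ i) r"
proof -
  have inv_pow: "(inv z ^^ l) ((z ^^ l) v) = v" "(z ^^ l) ((inv z ^^ l) v) = v" for l v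
    using inv_fn_o_fn_is_id[OF assms(1), of l] fn_o_inv_fn_is_id[OF assms(1), of l]
    by (metis comp_apply)+
  have "(inv z ^^ j) r = (inv z ^^ j) ((z ^^ i) ((z ^^ j) r))"
    by (simp only: inv_pow assms(2)[symmetric])
  also have "\<dots> = (inv z ^^ j) ((z ^^ j) ((z ^^ i) r))"
    by (metis add.commute comp_apply funpow_add)
  finally show ?thesis by (simp only: inv_pow)
qed

lemma alternating_funpow:
  assumes "bij z" and alt: "\<And>y. (z y \<in> S \<longleftrightarrow> y \<in> S) \<Longrightarrow> z y = y" and "z r \<noteq> r"
  shows "(z ^^ i) r \<in> S \<longleftrightarrow> (r \<in> S \<longleftrightarrow> even i)"
proof (induction i)
  case 0
  then show ?case by simp
next
  case (Suc i)
  have "z ((z ^^ i) r) \<noteq> (z ^^ i) r"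
  proof
    assume "z ((z ^^ i) r) = (z ^^ i) r"
    then have "(z ^^ i) (z r) = (z ^^ i) r" by (simp only: funpow_swap1)
    then show False
      using assms(3) inv_fn_o_fn_is_id[OF assms(1), of i] by (metis comp_apply)
  qed
  then have "z ((z ^^ i) r) \<in> S \<longleftrightarrow> (z ^^ i) r \<notin> S" using alt by blast
  then show ?case using Suc.IH by auto
qed

text \<open>
  Choose a base point \<open>r\<close> in every cycle and let \<open>g\<close> send the \<open>i\<close>-th iterate of \<open>r\<close> under \<open>z\<close> to its \<open>i\<close>-th
  iterate under \<open>inv z\<close>. This reflection of the cycle conjugates \<open>z\<close> into its inverse. Along a cycle
  that alternates between \<open>S\<close> and its complement, the parity of \<open>i\<close> decides whether the \<open>i\<close>-th iterate
  lies on the same side as \<open>r\<close>, and it does so in either direction; hence \<open>g\<close> preserves \<open>S\<close>.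
\<close>

lemma alternating_permutation_reversible:
  assumes "finite U" "z permutes U"
    and alt: "\<And>y. (z y \<in> S \<longleftrightarrow> y \<in> S) \<Longrightarrow> z y = y"
  shows "\<exists>g. g permutes U \<and> (\<forall>y. g y \<in> S \<longleftrightarrow> y \<in> S) \<and> inv z = g \<circ> z \<circ> inv g"
proof -
  have perm: "permutation z" using assms(1,2) by (auto simp: permutation_permutes)
  have bij: "bij z" using permutes_bij assms(2) by blast
  have orb: "orbit z y = {(z ^^ k) y |k. True}" for y
    by (rule orbit_altdef_permutation[OF perm])
  have self: "y \<in> orbit z y" for y
    by (rule permutation_self_in_orbit[OF perm])
  have orb_eq: "orbit z w = orbit z y" if "w \<in> orbit z y" for w y
    by (rule orbit_cyclic_eq3[OF cyclic_on_orbit'[OF perm] that])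
  define rep where "rep y = (SOME r. r \<in> orbit z y)" for y
  have rep_in: "rep y \<in> orbit z y" for y
    unfolding rep_def by (rule someI[of _ y]) (rule self)
  have rep_eq: "rep w = rep y" if "w \<in> orbit z y" for w y
    using orb_eq[OF that] by (simp add: rep_def)
  have "\<exists>k. (z ^^ k) (rep y) = y" for y
  proof -
    have "y \<in> orbit z (rep y)"
      using orb_eq[OF rep_in[of y]] self[of y] by simp
    then show ?thesis by (auto simp: orb) metis
  qed
  then obtain k where k: "\<And>y. (z ^^ k y) (rep y) = y" by metis
  define g where "g y = (inv z ^^ k y) (rep y)" for y
  have g_eq: "g y = (inv z ^^ i) (rep y)" if "y = (z ^^ i) (rep y)" for i y
    unfolding g_def by (rule funpow_inverse_eq[OF bij]) (metis k that)
  have g_orbit: "g y \<in> orbit z y" for y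
  proof -
    have "g y \<in> orbit (inv z) (rep y)"
      using perm by (auto simp: g_def orbit_altdef_permutation permutation_inverse)
    then show ?thesis
      using orb_eq[OF rep_in[of y]] by (simp add: orbit_inv_eq[OF perm])
  qed
  have g_inv: "g (g y) = y" for y
  proof -
    have rep: "rep (g y) = rep y" using rep_eq[OF g_orbit] .
    have 1: "g y = (z ^^ k (g y)) (rep y)" using k[of "g y"] rep by simp
    have "g (g y) = (inv z ^^ k (g y)) (rep y)" by (simp only: g_def[of "g y"] rep)
    also have "\<dots> = (z ^^ k y) (rep y)"
      by (rule funpow_inverse_swap[OF bij]) (simp only: 1[symmetric] g_def[symmetric])
    finally show ?thesis using k by simp
  qed
  have g_z: "g (z y) = inv z (g y)" for y
  proof -
    have rep: "rep (z y) = rep y" by (rule rep_eq) (rule orbit.base)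
    have "z y = (z ^^ Suc (k y)) (rep y)" using k[of y] by simp
    then have "g (z y) = (inv z ^^ Suc (k y)) (rep y)" using g_eq[of "z y" "Suc (k y)"] rep by simp
    then show ?thesis by (simp add: g_def)
  qed
  have fixed: "g y = y" if "z y = y" for y
    using g_orbit[of y] that orbit_eq_singleton_iff[of z y] by simp
  have "g permutes U"
    unfolding permutes_def
  proof (intro conjI allI impI)
    show "\<exists>!x. g x = y" for y
      using g_inv by metis
    show "g y = y" if "y \<notin> U" for y
      using that assms(2) by (intro fixed) (auto simp: permutes_def)
  qed
  moreover have "g y \<in> S \<longleftrightarrow> y \<in> S" for y
  proof (cases "z (rep y) = rep y")
    case True
    have "(z ^^ i) (rep y) = rep y" for i
      using True by (induction i) simp_all
    then have "y = rep y" using k[of y] by simp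
    then show ?thesis using True fixed by metis
  next
    case False
    have 1: "(z ^^ k y) (rep y) \<in> S \<longleftrightarrow> (rep y \<in> S \<longleftrightarrow> even (k y))"
      using bij alt False by (rule alternating_funpow)
    have "(inv z ^^ k y) (rep y) \<in> S \<longleftrightarrow> (rep y \<in> S \<longleftrightarrow> even (k y))"
    proof (rule alternating_funpow)
      show "bij (inv z)" using bij by (rule bij_imp_bij_inv)
      show "inv z v = v" if "inv z v \<in> S \<longleftrightarrow> v \<in> S" for v
        using alt[of "inv z v"] that by (simp add: permutes_inverses[OF assms(2)])
      show "inv z (rep y) \<noteq> rep y" using False by (metis permutes_inverses(1)[OF assms(2)])
    qed
    then show ?thesis using 1 k[of y] by (simp add: g_def)
  qed
  moreover have "inv z = g \<circ> z \<circ> inv g"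
  proof -
    have "inv g = g" using g_inv by (intro inv_unique_comp) (auto simp: fun_eq_iff)
    then show ?thesis by (simp add: fun_eq_iff g_z g_inv)
  qed
  ultimately show ?thesis by blast
qed

section \<open>Inverting an argument in a sum over permutations\<close>

lemma permutes_preserving_decompose:
  assumes "g permutes U" "S \<subseteq> U" "\<And>y. g y \<in> S \<longleftrightarrow> y \<in> S"
  shows "\<exists>c d. c permutes S \<and> d permutes U - S \<and> g = c \<circ> d"
proof -
  have bij: "bij g" using assms(1) by (rule permutes_bij)
  have S: "bij_betw g S S"
    using bij assms(3) by (auto simp: bij_betw_def bij_def inj_on_def surj_def image_iff) metis
  have T: "bij_betw g (U - S) (U - S)"
    using permutes_imp_bij[OF assms(1)] S assms(2) by (intro bij_betw_DiffI) auto
  let ?c = "\<lambda>y. if y \<in> S then g y else y" and ?d = "\<lambda>y. if y \<in> U - S then g y else y"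
  have "?c permutes S"
    using S by (intro bij_imp_permutes) (auto cong: bij_betw_cong)
  moreover have "?d permutes U - S"
  proof (rule bij_imp_permutes)
    show "bij_betw ?d (U - S) (U - S)"
      using T by (subst bij_betw_cong[of _ _ g]) auto
  qed auto
  moreover have "g = ?c \<circ> ?d"
    using assms by (auto simp: fun_eq_iff permutes_def)
  ultimately show ?thesis by blast
qed

lemma sum_permutations_conjugate:
  assumes "d permutes U"
  shows "(\<Sum>z | z permutes U. f (d \<circ> z \<circ> inv d)) = (\<Sum>z | z permutes U. f z)"
  using setum_permutations_compose_left[OF assms, of "\<lambda>z. f (z \<circ> inv d)"]
    sum_permutations_compose_right[OF permutes_inv[OF assms], of f] by simp

lemma permutes_disjoint_commute:
  assumes "c permutes S" "d permutes T" "S \<inter> T = {}"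
  shows "c \<circ> d = d \<circ> c"
proof
  fix y
  have "d y \<in> T \<longleftrightarrow> y \<in> T" "c y \<in> S \<longleftrightarrow> y \<in> S"
    using assms by (auto simp: permutes_in_image)
  moreover have "c v = v" if "v \<in> T" for v
    using assms(3) that by (intro permutes_not_in[OF assms(1)]) auto
  moreover have "d v = v" if "v \<in> S" for v
    using assms(3) that by (intro permutes_not_in[OF assms(2)]) auto
  ultimately show "(c \<circ> d) y = (d \<circ> c) y"
    using assms(1,2) by (cases "y \<in> S"; cases "y \<in> T") (simp_all add: permutes_not_in)
qed

text \<open>
  Since \<open>f\<close> is invariant under conjugation by permutations of \<open>T\<close>, the sum does not change when \<open>h\<close> is
  replaced by its average over these conjugations. Up to the factor \<open>fact (card T)\<close>, that average is \<open>H\<close>,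
  which is invariant under conjugation by permutations of \<open>S\<close> as well. The support conditions leave only
  those \<open>z\<close> that alternate between \<open>S\<close> and \<open>T\<close> off their fixed points; they are conjugate to their
  inverses by a product of a permutation of \<open>S\<close> and one of \<open>T\<close>, so \<open>H\<close> does not distinguish \<open>z\<close> from
  \<open>inv z\<close>.
\<close>

lemma sum_mult_inverse_argument:
  fixes f h :: "('a \<Rightarrow> 'a) \<Rightarrow> nat"
  assumes "finite U" "S \<subseteq> U" and T: "T = U - S"
    and f_conj: "\<And>d z. d permutes T \<Longrightarrow> f (d \<circ> z \<circ> inv d) = f z"
    and h_conj: "\<And>c z. c permutes S \<Longrightarrow> h (c \<circ> z \<circ> inv c) = h z"
    and f_supp: "\<And>z y. f z \<noteq> 0 \<Longrightarrow> y \<notin> S \<Longrightarrow> z y \<notin> S \<Longrightarrow> z y = y"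
    and h_supp: "\<And>z y. h z \<noteq> 0 \<Longrightarrow> y \<in> S \<Longrightarrow> z y \<in> S \<Longrightarrow> z y = y"
  shows "(\<Sum>z | z permutes U. f z * h (inv z)) = (\<Sum>z | z permutes U. f z * h z)"
proof -
  define H where "H z = (\<Sum>d | d permutes T. h (d \<circ> z \<circ> inv d))" for z
  have finT: "finite T" using assms(1) T by simp
  have TU: "d permutes U" if "d permutes T" for d
    using that T by (auto intro: permutes_subset)
  have average: "fact (card T) * (\<Sum>z | z permutes U. f z * k z)
      = (\<Sum>z | z permutes U. f z * (\<Sum>d | d permutes T. k (d \<circ> z \<circ> inv d)))" for k
  proof -
    have "(\<Sum>z | z permutes U. f z * k z)
        = (\<Sum>z | z permutes U. f z * k (d \<circ> z \<circ> inv d))" if "d permutes T" for d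
      using sum_permutations_conjugate[OF TU[OF that], of "\<lambda>z. f z * k z"]
      by (simp add: f_conj[OF that])
    then have "(\<Sum>d | d permutes T. \<Sum>z | z permutes U. f z * k z)
        = (\<Sum>d | d permutes T. \<Sum>z | z permutes U. f z * k (d \<circ> z \<circ> inv d))"
      by (rule sum.cong[OF refl]) (simp only: mem_Collect_eq)
    also have "\<dots> = (\<Sum>z | z permutes U. f z * (\<Sum>d | d permutes T. k (d \<circ> z \<circ> inv d)))"
      by (subst sum.swap) (simp add: sum_distrib_left)
    finally show ?thesis
      by (simp add: card_permutations[OF refl finT])
  qed
  have H_T: "H (d \<circ> z \<circ> inv d) = H z" if "d permutes T" for d z
  proof -
    have "H z = (\<Sum>e | e permutes T. h (e \<circ> d \<circ> z \<circ> inv (e \<circ> d)))"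
      unfolding H_def by (rule sum_permutations_compose_right[OF that])
    also have "\<dots> = H (d \<circ> z \<circ> inv d)"
      unfolding H_def using that
      by (intro sum.cong) (auto simp: o_inv_distrib permutes_bij comp_assoc)
    finally show ?thesis by simp
  qed
  have H_S: "H (c \<circ> z \<circ> inv c) = H z" if c: "c permutes S" for c z
    unfolding H_def
  proof (intro sum.cong refl)
    fix d
    assume "d \<in> {d. d permutes T}"
    then have d: "d permutes T" by simp
    have comm: "c \<circ> d = d \<circ> c"
      using c d by (rule permutes_disjoint_commute) (auto simp: T)
    have "d \<circ> (c \<circ> z \<circ> inv c) \<circ> inv d = (d \<circ> c) \<circ> z \<circ> inv (d \<circ> c)"
      using c d by (simp add: o_inv_distrib permutes_bij comp_assoc)
    also have "\<dots> = c \<circ> (d \<circ> z \<circ> inv d) \<circ> inv c"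
      unfolding comm[symmetric] using c d by (simp add: o_inv_distrib permutes_bij comp_assoc)
    finally show "h (d \<circ> (c \<circ> z \<circ> inv c) \<circ> inv d) = h (d \<circ> z \<circ> inv d)"
      by (simp add: h_conj[OF c])
  qed
  have H_supp: "z y = y" if nz: "H z \<noteq> 0" and y: "y \<in> S" "z y \<in> S" for z y
  proof -
    obtain d where d: "d permutes T" and "h (d \<circ> z \<circ> inv d) \<noteq> 0"
      using nz unfolding H_def
      by (metis (mono_tags, lifting) mem_Collect_eq sum.not_neutral_contains_not_neutral)
    moreover have "inv d y = y" "d (z y) = z y"
      using y permutes_not_in[OF d] permutes_not_in[OF permutes_inv[OF d]] by (auto simp: T)
    ultimately show ?thesis
      using h_supp[of "d \<circ> z \<circ> inv d" y] y by simp
  qed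
  have H_inv: "H (inv z) = H z" if z: "z permutes U" and "f z \<noteq> 0" for z
  proof (cases "H z = 0 \<and> H (inv z) = 0")
    case False
    have "z y = y" if "z y \<in> S \<longleftrightarrow> y \<in> S" for y
    proof (cases "y \<in> S")
      case True
      \<comment> \<open>If \<open>inv z\<close> fixes every point of \<open>S\<close> that it keeps in \<open>S\<close>, then so does \<open>z\<close>.\<close>
      have "z y = y" if "H (inv z) \<noteq> 0"
        using H_supp[OF that, of "z y"] True \<open>z y \<in> S \<longleftrightarrow> y \<in> S\<close>
        by (simp add: permutes_inverses[OF z])
      then show ?thesis using False H_supp[of z y] True \<open>z y \<in> S \<longleftrightarrow> y \<in> S\<close> by auto
    next
      case False
      then show ?thesis using f_supp \<open>f z \<noteq> 0\<close> that by blast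
    qed
    then obtain g where "g permutes U" "\<And>y. g y \<in> S \<longleftrightarrow> y \<in> S" and g: "inv z = g \<circ> z \<circ> inv g"
      using alternating_permutation_reversible[OF assms(1) z] by metis
    then obtain c d where cd: "c permutes S" "d permutes T" "g = c \<circ> d"
      using permutes_preserving_decompose[OF _ assms(2)] T by metis
    then have "inv z = c \<circ> (d \<circ> z \<circ> inv d) \<circ> inv c"
      using g by (simp add: o_inv_distrib permutes_bij comp_assoc)
    then show ?thesis using H_S[OF cd(1)] H_T[OF cd(2)] by simp
  qed simp
  have "H (inv z) = (\<Sum>d | d permutes T. h (inv (d \<circ> z \<circ> inv d)))" if "z permutes U" for z
    unfolding H_def using that
    by (intro sum.cong)
      (auto simp: o_inv_distrib permutes_bij bij_comp bij_imp_bij_inv inv_inv_eq comp_assoc)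
  then have "fact (card T) * (\<Sum>z | z permutes U. f z * h (inv z))
      = (\<Sum>z | z permutes U. f z * H (inv z))"
    unfolding average[of "\<lambda>z. h (inv z)"] by (intro sum.cong) auto
  also have "\<dots> = (\<Sum>z | z permutes U. f z * H z)"
    using H_inv by (intro sum.cong) auto
  also have "\<dots> = fact (card T) * (\<Sum>z | z permutes U. f z * h z)"
    unfolding average[of h] H_def ..
  finally show ?thesis by simp
qed

section \<open>Flipping one block of a permutation\<close>

text \<open>
  The invariances of the two block counts rewrite both sides as sums over \<open>z\<close> that differ only in
  \<open>\<rho> \<circ> inv z\<close> versus \<open>\<rho> \<circ> z\<close>, which is the situation of \<open>sum_mult_inverse_argument\<close>. The map \<open>\<sigma>\<close> may be
  any involution that reverses the list of centres \<open>xs\<close>.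
\<close>

lemma factorization_count_flip:
  fixes U :: "'a set"
  assumes "finite U" "set xs \<subseteq> U" and T: "T = U - set xs" and ys: "set ys = T"
    and dist: "distinct xs" "distinct ys"
    and \<tau>: "\<tau> permutes set xs" and \<rho>: "\<rho> permutes T"
    and \<sigma>: "\<sigma> permutes set xs" "map \<sigma> xs = rev xs" "\<sigma> \<circ> \<sigma> = id"
  shows "factorization_count U (ys @ xs) (\<sigma> \<circ> inv \<tau> \<circ> \<sigma> \<circ> \<rho>)
       = factorization_count U (ys @ xs) (\<tau> \<circ> \<rho>)"
proof -
  let ?A = "factorization_count U xs" and ?B = "factorization_count U ys"
  have ysU: "set ys \<subseteq> U" and disj: "set xs \<inter> T = {}" using ys T by auto
  have SU: "c permutes U" if "c permutes set xs" for c
    using that assms(2) by (rule permutes_subset)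
  have \<tau>U: "\<tau> permutes U" and \<sigma>U: "\<sigma> permutes U" using SU \<tau> \<sigma>(1) by auto
  have \<rho>U: "\<rho> permutes U" using \<rho> T by (auto intro: permutes_subset)
  have inv_\<sigma>: "inv \<sigma> = \<sigma>" using \<sigma>(3) by (rule inv_unique_comp[OF _ \<sigma>(3)])
  have A_conj: "?A (d \<circ> z \<circ> inv d) = ?A z" if "d permutes T" for d z
    using that by (rule factorization_count_conjugate_fixing) (auto simp: T)
  have B_conj: "?B (c \<circ> z \<circ> inv c) = ?B z" if "c permutes set xs" for c z
    using that assms(2) by (rule factorization_count_conjugate_fixing) (auto simp: T ys)
  have A_flip: "?A (\<sigma> \<circ> inv x \<circ> \<sigma>) = ?A x" if "x permutes U" for x
  proof -
    have "?A (\<sigma> \<circ> inv x \<circ> \<sigma>) = factorization_count U (map \<sigma> (rev xs)) (\<sigma> \<circ> inv x \<circ> inv \<sigma>)"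
      by (simp add: rev_map[symmetric] \<sigma>(2) inv_\<sigma>)
    also have "\<dots> = factorization_count U (rev xs) (inv x)"
      by (rule factorization_count_conjugate[OF \<sigma>U])
    also have "\<dots> = ?A x"
      using factorization_count_inverse[OF permutes_bij[OF that], of U "rev xs"] by simp
    finally show ?thesis .
  qed
  have comm: "c \<circ> \<rho> = \<rho> \<circ> c" if "c permutes set xs" for c
    using that \<rho> disj by (rule permutes_disjoint_commute)
  have inv_comp: "inv (p \<circ> q) = inv q \<circ> inv p" if "p permutes U" "q permutes U" for p q
    using that by (simp add: o_inv_distrib permutes_bij)

  have orig: "factorization_count U (ys @ xs) (\<tau> \<circ> \<rho>)
      = (\<Sum>z | z permutes U. ?A (\<tau> \<circ> z) * ?B (\<rho> \<circ> inv z))"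
  proof -
    have "factorization_count U (ys @ xs) (\<tau> \<circ> \<rho>)
        = (\<Sum>x | x permutes U. ?B (\<tau> \<circ> \<rho> \<circ> inv x) * ?A x)"
      by (rule factorization_count_append[OF assms(1) ysU permutes_compose[OF \<rho>U \<tau>U]])
    \<comment> \<open>With \<open>x = \<tau> z\<close>, the argument of \<open>?B\<close> becomes the conjugate of \<open>\<rho> \<circ> inv z\<close> by \<open>\<tau>\<close>.\<close>
    also have "\<dots> = (\<Sum>z | z permutes U. ?B (\<tau> \<circ> \<rho> \<circ> inv (\<tau> \<circ> z)) * ?A (\<tau> \<circ> z))"
      by (rule setum_permutations_compose_left[OF \<tau>U])
    also have "\<dots> = (\<Sum>z | z permutes U. ?A (\<tau> \<circ> z) * ?B (\<rho> \<circ> inv z))"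
    proof (intro sum.cong refl)
      fix z
      assume "z \<in> {z. z permutes U}"
      then have "\<tau> \<circ> \<rho> \<circ> inv (\<tau> \<circ> z) = \<tau> \<circ> (\<rho> \<circ> inv z) \<circ> inv \<tau>"
        using inv_comp[OF \<tau>U] by (simp add: comp_assoc)
      then show "?B (\<tau> \<circ> \<rho> \<circ> inv (\<tau> \<circ> z)) * ?A (\<tau> \<circ> z) = ?A (\<tau> \<circ> z) * ?B (\<rho> \<circ> inv z)"
        using B_conj[OF \<tau>] by simp
    qed
    finally show ?thesis .
  qed

  have flipped: "factorization_count U (ys @ xs) (\<sigma> \<circ> inv \<tau> \<circ> \<sigma> \<circ> \<rho>)
      = (\<Sum>z | z permutes U. ?A (\<tau> \<circ> z) * ?B (\<rho> \<circ> z))"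
  proof -
    let ?p = "\<sigma> \<circ> inv \<tau> \<circ> \<sigma> \<circ> \<rho>"
    have pU: "?p permutes U"
      by (intro permutes_compose permutes_inv \<tau>U \<sigma>U \<rho>U)
    have "factorization_count U (ys @ xs) ?p = (\<Sum>x | x permutes U. ?B (?p \<circ> inv x) * ?A x)"
      by (rule factorization_count_append[OF assms(1) ysU pU])
    \<comment> \<open>The next two steps replace \<open>x\<close> by \<open>\<sigma> x\<inverse> \<sigma>\<close>, which leaves \<open>?A\<close> unchanged and undoes the
        inversion of the summation variable in \<open>?B\<close>.\<close>
    also have "\<dots> = (\<Sum>x | x permutes U. ?B (?p \<circ> inv (\<sigma> \<circ> x \<circ> inv \<sigma>)) * ?A (\<sigma> \<circ> x \<circ> inv \<sigma>))"
      by (rule sum_permutations_conjugate[OF \<sigma>U, symmetric])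
    also have "\<dots> = (\<Sum>x | x permutes U.
        ?B (?p \<circ> inv (\<sigma> \<circ> inv x \<circ> inv \<sigma>)) * ?A (\<sigma> \<circ> inv x \<circ> inv \<sigma>))"
      by (rule sum_permutations_inverse)
    also have "\<dots> = (\<Sum>x | x permutes U. ?B (inv \<tau> \<circ> \<rho> \<circ> x) * ?A x)"
    proof (intro sum.cong refl)
      fix x
      assume "x \<in> {x. x permutes U}"
      then have x: "x permutes U" by simp
      have "inv (\<sigma> \<circ> inv x \<circ> inv \<sigma>) = \<sigma> \<circ> x \<circ> inv \<sigma>"
        using x \<sigma>U by (simp add: inv_comp permutes_compose permutes_inv permutes_inv_inv comp_assoc)
      then have "?p \<circ> inv (\<sigma> \<circ> inv x \<circ> inv \<sigma>) = \<sigma> \<circ> inv \<tau> \<circ> (\<sigma> \<circ> \<rho>) \<circ> \<sigma> \<circ> x \<circ> inv \<sigma>"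
        by (simp add: comp_assoc)
      also have "\<dots> = \<sigma> \<circ> (inv \<tau> \<circ> \<rho> \<circ> (\<sigma> \<circ> \<sigma>) \<circ> x) \<circ> inv \<sigma>"
        unfolding comm[OF \<sigma>(1)] by (simp only: comp_assoc)
      finally have "?B (?p \<circ> inv (\<sigma> \<circ> inv x \<circ> inv \<sigma>)) = ?B (inv \<tau> \<circ> \<rho> \<circ> x)"
        using B_conj[OF \<sigma>(1)] \<sigma>(3) by simp
      then show "?B (?p \<circ> inv (\<sigma> \<circ> inv x \<circ> inv \<sigma>)) * ?A (\<sigma> \<circ> inv x \<circ> inv \<sigma>)
          = ?B (inv \<tau> \<circ> \<rho> \<circ> x) * ?A x"
        using A_flip[OF x] by (simp add: inv_\<sigma>)
    qed
    also have "\<dots> = (\<Sum>z | z permutes U. ?B (inv \<tau> \<circ> \<rho> \<circ> (\<tau> \<circ> z)) * ?A (\<tau> \<circ> z))"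
      by (rule setum_permutations_compose_left[OF \<tau>U])
    also have "\<dots> = (\<Sum>z | z permutes U. ?B (\<rho> \<circ> z) * ?A (\<tau> \<circ> z))"
    proof (intro sum.cong refl)
      fix z :: "'a \<Rightarrow> 'a"
      have "inv \<tau> \<circ> \<rho> \<circ> (\<tau> \<circ> z) = inv \<tau> \<circ> (\<rho> \<circ> \<tau>) \<circ> z" by (simp only: comp_assoc)
      also have "\<dots> = (inv \<tau> \<circ> \<tau>) \<circ> \<rho> \<circ> z"
        unfolding comm[OF \<tau>, symmetric] by (simp only: comp_assoc)
      finally have "inv \<tau> \<circ> \<rho> \<circ> (\<tau> \<circ> z) = \<rho> \<circ> z"
        by (simp add: permutes_inv_o[OF \<tau>])
      then show "?B (inv \<tau> \<circ> \<rho> \<circ> (\<tau> \<circ> z)) * ?A (\<tau> \<circ> z) = ?B (\<rho> \<circ> z) * ?A (\<tau> \<circ> z)"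
        by simp
    qed
    finally show ?thesis by (simp add: mult.commute)
  qed

  have "(\<Sum>z | z permutes U. ?A (\<tau> \<circ> z) * ?B (\<rho> \<circ> inv z))
      = (\<Sum>z | z permutes U. ?A (\<tau> \<circ> z) * ?B (\<rho> \<circ> z))"
  proof (rule sum_mult_inverse_argument[OF assms(1,2) T])
    fix d z
    assume d: "d permutes T"
    have "\<tau> \<circ> (d \<circ> z \<circ> inv d) = d \<circ> (\<tau> \<circ> z) \<circ> inv d"
      using permutes_disjoint_commute[OF \<tau> d disj] by (metis comp_assoc)
    then show "?A (\<tau> \<circ> (d \<circ> z \<circ> inv d)) = ?A (\<tau> \<circ> z)"
      using A_conj[OF d] by simp
  next
    fix c z
    assume c: "c permutes set xs"
    have "\<rho> \<circ> (c \<circ> z \<circ> inv c) = c \<circ> (\<rho> \<circ> z) \<circ> inv c"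
      using comm[OF c] by (metis comp_assoc)
    then show "?B (\<rho> \<circ> (c \<circ> z \<circ> inv c)) = ?B (\<rho> \<circ> z)"
      using B_conj[OF c] by simp
  next
    fix z y
    assume "?A (\<tau> \<circ> z) \<noteq> 0" "y \<notin> set xs" "z y \<notin> set xs"
    then show "z y = y"
      using factorization_count_support[of U xs "\<tau> \<circ> z" y] dist(1) permutes_not_in[OF \<tau>] by simp
  next
    fix z y
    assume "?B (\<rho> \<circ> z) \<noteq> 0" "y \<in> set xs" "z y \<in> set xs"
    moreover from this have "\<rho> (z y) = z y" "y \<notin> set ys" "z y \<notin> set ys"
      using permutes_not_in[OF \<rho>] T ys by auto
    ultimately show "z y = y"
      using factorization_count_support[of U ys "\<rho> \<circ> z" y] dist(2) by simp
  qed
  then show ?thesis using orig flipped by simp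
qed

theorem theorem11:
  fixes n m :: nat and \<rho>1 \<rho>2 :: "nat \<Rightarrow> nat"
  assumes "\<rho>1 permutes {1..n}" and "\<rho>2 permutes {1..m}"
  shows "multiplicity_perm (m + n) (concat_perm n m (flip_perm n \<rho>1) \<rho>2)
       = multiplicity_perm (m + n) (concat_perm n m \<rho>1 \<rho>2)"
proof -
  let ?xs = "rev [1..<Suc n]" and ?ys = "rev [Suc n..<Suc (m + n)]"
  let ?r = "concat_perm n m id \<rho>2"
  have set_xs: "set ?xs = {1..n}" and set_ys: "set ?ys = {1..m + n} - set ?xs" by auto
  have "?r permutes {1..m + n}"
    by (rule concat_perm_permutes[OF permutes_id assms(2)])
  then have r: "?r permutes {1..m + n} - set ?xs"
    by (rule permutes_superset) (auto simp: concat_perm_def)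
  have split: "concat_perm n m p \<rho>2 = p \<circ> ?r" if p: "p permutes {1..n}" for p
  proof
    fix j
    have "\<rho>2 (j - n) \<in> {1..m}" if "j \<in> {n + 1..m + n}"
      using that permutes_in_image[OF assms(2), of "j - n"] by auto
    then show "concat_perm n m p \<rho>2 j = (p \<circ> ?r) j"
      using permutes_not_in[OF p] by (auto simp: concat_perm_def)
  qed
  have "[1..<Suc (m + n)] = [1..<Suc n] @ [Suc n..<Suc (m + n)]"
    using upt_add_eq_append[of 1 "Suc n" m] by (simp add: add.commute)
  then have mult: "multiplicity_perm (m + n) p = factorization_count {1..m + n} (?ys @ ?xs) p" for p
    by (simp only: multiplicity_perm_eq rev_append)
  have "map (reversal_perm n) ?xs = rev ?xs"
    by (rule nth_equalityI) (auto simp: rev_nth reversal_perm_def simp del: upt_Suc)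
  moreover have "reversal_perm n \<circ> reversal_perm n = id"
    by (auto simp: reversal_perm_def fun_eq_iff)
  ultimately have "factorization_count {1..m + n} (?ys @ ?xs)
        (reversal_perm n \<circ> inv \<rho>1 \<circ> reversal_perm n \<circ> ?r)
      = factorization_count {1..m + n} (?ys @ ?xs) (\<rho>1 \<circ> ?r)"
    using assms(1) r reversal_perm_permutes[of n]
    by (intro factorization_count_flip[OF _ _ refl set_ys]) (simp_all only: set_xs, auto)
  then show ?thesis
    using split[OF assms(1)] split[OF flip_perm_permutes[OF assms(1)]]
    by (simp add: mult flip_perm_def)
qed

end
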